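(* Let $a \in \mathbb{R}$ and $n \in \mathbb{N}$. Then $$P_{n}(a) := \int_{0}^{1} x^{n} e^{-ax}\, dx = \frac{n!}{a^{n+1}} \left[ 1 - e^{-a}\, \mathrm{Exp}_{n}(a) \right],$$ and $$Q_{n}(a) := \int_{0}^{1} x^{n} e^{-ax} \ln x \, dx = \frac{n!}{a^{n+1}} \left[ H_{n} - G(a) - e^{-a} \sum_{k=1}^{n} \frac{1}{k}\, \mathrm{Exp}_{k-1}(a) \right],$$ where $G(a) = -a\,Q_{0}(a) = \gamma + \Gamma(0,a) + \ln a$.
   Context: Here $H_{n} = \sum_{k=1}^{n} \frac{1}{k}$ denotes the harmonic numbers, $\mathrm{Exp}_{n}(x) = \sum_{k=0}^{n} \frac{x^{k}}{k!}$ denotes the partial sums of the exponential function, $\gamma = \lim_{n\to\infty}\left(\sum_{k=1}^{n} \frac{1}{k} - \ln n\right)$ is Euler's constant, $Q_{0}(a) = \int_{0}^{1} e^{-ax} \ln x \, dx$, and $\Gamma(0,a)$ is the value at $s=0$, $x=a$ of the incomplete gamma function $\Gamma(s,x) = \int_{x}^{\infty} t^{s-1} e^{-t}\, dt$.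
   Formalization: The case a = 0 is excluded, since the right-hand sides divide by a^{n+1} and contain ln a; for a < 0, where the integral for Γ(0,a) diverges and ln a is not real, both are read as principal branches (limits from the upper half plane), so the formula for G(a) is stated over the complex numbers. *)

theory Defs
  imports "HOL-Analysis.Analysis"
begin

definition Exp_partial :: "nat \<Rightarrow> real \<Rightarrow> real" where
  "Exp_partial n x = (\<Sum>k=0..n. x ^ k / fact k)"

definition P_int :: "nat \<Rightarrow> real \<Rightarrow> real" where
  "P_int n a = (LINT x:{0..1}|lborel. x ^ n * exp (- a * x))"

definition Q_int :: "nat \<Rightarrow> real \<Rightarrow> real" where
  "Q_int n a = (LINT x:{0..1}|lborel. x ^ n * exp (- a * x) * ln x)"

definition G_fun :: "real \<Rightarrow> real" where
  "G_fun a = - a * Q_int 0 a"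

text \<open>
  For \<open>x < 0\<close> the integral over \<open>[x, \<infinity>)\<close> runs through the singularity of \<open>t powr (s - 1)\<close> at 0
  (for \<open>s = 0\<close> it diverges). There \<open>\<Gamma>(s, x)\<close> denotes the principal branch, whose cut is the negative
  real axis and which is continuous from above on it, as is the principal logarithm \<^const>\<open>Ln\<close>: it is
  the limit of the integrals along the rays \<open>x + i \<epsilon> + [0, \<infinity>)\<close> as \<open>\<epsilon>\<close> tends to 0 from the right.
\<close>

definition inc_Gamma :: "complex \<Rightarrow> real \<Rightarrow> complex" where
  "inc_Gamma s x =
    (if x \<ge> 0 then (LINT t:{x..}|lborel. of_real t powr (s - 1) * exp (- of_real t))
     else Lim (at_right 0) (\<lambda>\<epsilon>::real.
       LINT t:{x..}|lborel. Complex t \<epsilon> powr (s - 1) * exp (- Complex t \<epsilon>)))"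

end

theory Submission
  imports Defs "HOL-Real_Asymp.Real_Asymp"
begin

text \<open>
  Let \<open>Ein\<close> be the entire function with \<open>Ein 0 = 0\<close> and derivative \<open>(1 - exp (- z)) / z\<close>.
  Then \<open>(1 - exp (- a * x)) * ln x - Ein (a * x)\<close> is a primitive of \<open>a * exp (- a * x) * ln x\<close>, so that
  \<open>G(a) = Ein a\<close>. On the slit plane \<open>Ln w - Ein w\<close> is a primitive of \<open>exp (- w) / w\<close>, and it tends
  to \<open>- \<gamma>\<close> along every horizontal ray to the right, so that \<open>\<Gamma>(0, z) = Ein z - \<gamma> - Ln z\<close>; on the
  negative axis this persists as the limit from above. The closed forms for \<open>P\<^sub>n\<close> and \<open>Q\<^sub>n\<close> come from
  a primitive and from \<open>a * Q\<^sub>n\<^sub>+\<^sub>1 = (n + 1) * Q\<^sub>n + P\<^sub>n\<close>, which is integration by parts.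
\<close>

section \<open>The entire exponential integral\<close>

text \<open>At \<open>n = 0\<close> the denominator is 0 and division by zero gives 0, so the series
  starts with its linear term. The general field type lets real estimates be reused for complex
  arguments.\<close>

definition Ein_coeff :: "nat \<Rightarrow> 'a::{real_normed_field,banach}" where
  "Ein_coeff n = - ((-1) ^ n / (of_nat n * fact n))"

definition Ein :: "'a::{real_normed_field,banach} \<Rightarrow> 'a" where
  "Ein z = (\<Sum>n. Ein_coeff n * z ^ n)"

lemma summable_Ein: "summable (\<lambda>n. Ein_coeff n * (z :: 'a::{real_normed_field,banach}) ^ n)"
proof (rule summable_comparison_test)
  show "\<exists>N. \<forall>n\<ge>N. norm (Ein_coeff n * z ^ n) \<le> norm z ^ n /\<^sub>R fact n"
  proof (intro exI allI impI)
    fix n :: nat assume "n \<ge> 1"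
    then have "norm z ^ n * fact n \<le> norm z ^ n * (real n * fact n)"
      by (intro mult_left_mono) auto
    with \<open>n \<ge> 1\<close> show "norm (Ein_coeff n * z ^ n) \<le> norm z ^ n /\<^sub>R fact n"
      by (simp add: Ein_coeff_def norm_mult norm_divide norm_power field_simps)
  qed
  show "summable (\<lambda>n. norm z ^ n /\<^sub>R fact n)"
    by (rule summable_exp_generic)
qed

lemma Ein_0 [simp]: "Ein 0 = 0"
  by (simp only: Ein_def powser_zero) (simp add: Ein_coeff_def)

lemma Ein_of_real: "Ein (of_real x :: 'a::{real_normed_field,banach}) = of_real (Ein x)"
proof -
  have "(\<lambda>n. of_real (Ein_coeff n * x ^ n) :: 'a) sums of_real (Ein x)"
    unfolding Ein_def by (intro sums_of_real summable_sums summable_Ein)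
  then show ?thesis
    by (auto simp: Ein_def Ein_coeff_def sums_iff)
qed

lemma diffs_Ein_coeff: "diffs Ein_coeff n = (-1) ^ n / (fact (Suc n) :: 'a::{real_normed_field,banach})"
proof -
  have "of_nat (Suc n) \<noteq> (0::'a)" by (rule of_nat_neq_0)
  then show ?thesis by (simp add: diffs_def Ein_coeff_def field_simps del: of_nat_Suc)
qed

lemma DERIV_Ein_series:
  "(Ein has_field_derivative (\<Sum>n. diffs Ein_coeff n * z ^ n)) (at (z :: 'a::{real_normed_field,banach}))"
  unfolding Ein_def[abs_def] by (rule termdiffs_strong_converges_everywhere) (rule summable_Ein)

text \<open>Removing the constant term from the series of \<open>exp (- z)\<close> and dividing by
  \<open>- z\<close> gives the termwise derivative of the series of \<open>Ein\<close>.\<close>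

lemma has_field_derivative_Ein:
  assumes "z \<noteq> (0 :: 'a::{real_normed_field,banach})"
  shows "(Ein has_field_derivative (1 - exp (- z)) / z) (at z)"
proof -
  have "(\<lambda>n. (- z) ^ n /\<^sub>R fact n) sums exp (- z)"
    by (rule exp_converges)
  then have "(\<lambda>n. (- z) ^ Suc n /\<^sub>R fact (Suc n)) sums (exp (- z) - 1)"
    by (subst sums_Suc_iff) simp
  then have "(\<lambda>n. (- 1 / z) * ((- z) ^ Suc n /\<^sub>R fact (Suc n))) sums ((- 1 / z) * (exp (- z) - 1))"
    by (rule sums_mult)
  also have "(\<lambda>n. (- 1 / z) * ((- z) ^ Suc n /\<^sub>R fact (Suc n))) = (\<lambda>n. diffs Ein_coeff n * z ^ n)"
    unfolding diffs_Ein_coeff scaleR_conv_of_real using assms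
    by (intro ext) (simp add: field_simps power_minus[of z] del: fact_Suc)
  also have "(- 1 / z) * (exp (- z) - 1) = (1 - exp (- z)) / z"
    using assms by (simp add: field_simps)
  finally show ?thesis
    using DERIV_Ein_series[of z] by (simp add: sums_iff)
qed

lemma isCont_Ein: "isCont Ein (z :: 'a::{real_normed_field,banach})"
  using DERIV_Ein_series by (rule DERIV_isCont)

lemma continuous_on_Ein [continuous_intros]:
  fixes f :: "_ \<Rightarrow> 'a::{real_normed_field,banach}"
  assumes "continuous_on A f"
  shows "continuous_on A (\<lambda>x. Ein (f x))"
  using assms isCont_Ein by (metis continuous_at_imp_continuous_on continuous_on_compose2 subset_UNIV)

section \<open>Comparison with harmonic numbers and Euler's constant\<close>

lemma exp_minus_diff_power_le:
  fixes t :: real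
  assumes "0 \<le> t" "t \<le> real n" "n > 0"
  shows "exp (- t) - (1 - t / n) ^ n \<le> t\<^sup>2 * exp (- t) / n"
proof -
  have "(t / n)\<^sup>2 \<le> 1"
    using assms by (simp add: power_le_one)
  \<comment> \<open>Bernoulli is applied to \<open>1 - (t / n)^2\<close>, which splits into
    \<open>1 - t / n\<close> and \<open>1 + t / n\<close>; the n-th power of the latter is at most
    \<open>exp t\<close>.\<close>
  then have "1 + real n * (- ((t / n)\<^sup>2)) \<le> (1 + (- ((t / n)\<^sup>2))) ^ n"
    by (intro Bernoulli_inequality) auto
  also have "\<dots> = (1 - t / n) ^ n * (1 + t / n) ^ n"
    by (simp add: power_mult_distrib [symmetric] power2_eq_square algebra_simps)
  also have "\<dots> \<le> (1 - t / n) ^ n * exp t"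
    using assms by (intro mult_left_mono exp_ge_one_plus_x_over_n_power_n) auto
  finally have "1 - t\<^sup>2 / n \<le> (1 - t / n) ^ n * exp t"
    using assms by (simp add: power2_eq_square)
  then have "(1 - t\<^sup>2 / n) * exp (- t) \<le> (1 - t / n) ^ n * exp t * exp (- t)"
    by (intro mult_right_mono) auto
  also have "\<dots> = (1 - t / n) ^ n"
    by (simp add: exp_minus)
  finally show ?thesis
    by (simp add: algebra_simps)
qed

text \<open>
  Compares \<open>Ein n\<close> with \<open>harm n\<close>, the integral of \<open>(1 - (1 - t / n) ^ n) / t\<close> over \<open>[0, n]\<close>:
  the integrands differ by at most \<open>t * exp (- t) / n\<close>.
\<close>

lemma Ein_harm_bounds:
  assumes "n > 0"
  shows "Ein (real n) \<le> harm n" "harm n - 1 / n \<le> Ein (real n)"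
proof -
  \<comment> \<open>By the geometric sum, \<open>S\<close> is the primitive of
    \<open>(1 - (1 - t / n) ^ n) / t\<close> that vanishes at 0; at \<open>t = n\<close> each
    numerator is 1, which leaves \<open>harm n\<close>.\<close>
  define S where "S = (\<lambda>t::real. \<Sum>k=1..n. (1 - (1 - t / n) ^ k) / k)"
  \<comment> \<open>The last summand is the primitive of the error bound
    \<open>t * exp (- t) / n\<close> vanishing at 0. Adding it makes \<open>E\<close> increasing,
    and it never exceeds \<open>1 / n\<close> for nonnegative \<open>t\<close>.\<close>
  define E where "E = (\<lambda>t::real. Ein t - S t + (1 - (1 + t) * exp (- t)) / n)"
  have S0: "S 0 = 0" and Sn: "S n = harm n"
    using assms by (auto simp: S_def harm_def field_simps intro!: sum.cong)
  have S': "(S has_real_derivative (1 - (1 - t / n) ^ n) / t) (at t)" if "t > 0" for t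
  proof -
    have "(S has_real_derivative (\<Sum>k=1..n. (1 - t / n) ^ (k - 1) / n)) (at t)"
      unfolding S_def
    proof (intro DERIV_sum)
      fix k assume "k \<in> {1..n}"
      then show "((\<lambda>t. (1 - (1 - t / n) ^ k) / k) has_real_derivative (1 - t / n) ^ (k - 1) / n) (at t)"
        using assms by (auto intro!: derivative_eq_intros)
    qed
    also have "(\<Sum>k=1..n. (1 - t / n) ^ (k - 1) / n) = (\<Sum>k<n. (1 - t / n) ^ k) / n"
      by (simp add: sum_divide_distrib sum.atLeast1_atMost_eq)
    also have "\<dots> = (1 - (1 - t / n) ^ n) / t"
      using that assms by (simp add: sum_gp_strict)
    finally show ?thesis .
  qed
  have cont: "continuous_on {0..real n} S"
    unfolding S_def using assms by (intro continuous_intros) auto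
  have D': "((\<lambda>t. Ein t - S t) has_real_derivative ((1 - t / n) ^ n - exp (- t)) / t) (at t)"
    if "t > 0" for t
    by (rule DERIV_cong, rule DERIV_diff[OF has_field_derivative_Ein S'])
       (use that in \<open>auto simp: diff_divide_distrib\<close>)
  have E': "(E has_real_derivative ((1 - t / n) ^ n - exp (- t)) / t + t * exp (- t) / n) (at t)"
    if "t > 0" for t
    unfolding E_def
    by (rule DERIV_add[OF D'[OF that]])
       (use assms in \<open>auto intro!: derivative_eq_intros simp: field_simps\<close>)
  have "Ein (real n) - S n \<le> Ein 0 - S 0"
  proof (rule DERIV_nonpos_imp_decreasing_open[of 0 "real n" "\<lambda>t. Ein t - S t"])
    fix t :: real assume t: "0 < t" "t < n"
    have "(1 - t / n) ^ n \<le> exp (- t)"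
      using t assms by (intro exp_ge_one_minus_x_over_n_power_n) auto
    with D'[of t] t show "\<exists>y. ((\<lambda>t. Ein t - S t) has_real_derivative y) (at t) \<and> y \<le> 0"
      by (intro exI[of _ "((1 - t / n) ^ n - exp (- t)) / t"]) (auto simp: divide_le_0_iff)
  qed (auto intro!: continuous_intros cont)
  then show "Ein (real n) \<le> harm n"
    by (simp add: S0 Sn)
  have "E 0 \<le> E n"
  proof (rule DERIV_nonneg_imp_increasing_open[of 0 "real n" E])
    fix t :: real assume t: "0 < t" "t < n"
    have "exp (- t) - (1 - t / n) ^ n \<le> t\<^sup>2 * exp (- t) / n"
      using t assms by (intro exp_minus_diff_power_le) auto
    then have "0 \<le> ((1 - t / n) ^ n - exp (- t) + t\<^sup>2 * exp (- t) / n) / t"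
      using t by (intro divide_nonneg_pos) auto
    also have "\<dots> = ((1 - t / n) ^ n - exp (- t)) / t + t * exp (- t) / n"
      using t by (simp add: add_divide_distrib power2_eq_square)
    finally show "\<exists>y. (E has_real_derivative y) (at t) \<and> y \<ge> 0"
      using E'[of t] t by blast
  qed (use assms in \<open>auto simp: E_def intro!: continuous_intros cont\<close>)
  moreover have "(1 - (1 + real n) * exp (- real n)) / n \<le> 1 / n"
    by (intro divide_right_mono) auto
  ultimately show "harm n - 1 / n \<le> Ein (real n)"
    by (simp add: E_def S0 Sn)
qed

text \<open>Supplies the constant of integration for the incomplete gamma function. A limit along
  the integers is enough, since the improper integrals are shown to converge separately.\<close>

lemma Ein_minus_ln_LIMSEQ: "(\<lambda>n. Ein (real n) - ln (real n)) \<longlonglongrightarrow> euler_mascheroni"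
proof (rule tendsto_sandwich)
  show "eventually (\<lambda>n. harm n - ln (real n) - 1 / real n \<le> Ein (real n) - ln (real n)) sequentially"
    using eventually_gt_at_top[of 0] by eventually_elim (use Ein_harm_bounds in force)
  show "eventually (\<lambda>n. Ein (real n) - ln (real n) \<le> harm n - ln (real n)) sequentially"
    using eventually_gt_at_top[of 0] by eventually_elim (use Ein_harm_bounds in force)
  show "(\<lambda>n. harm n - ln (real n) - 1 / real n) \<longlonglongrightarrow> euler_mascheroni"
    using tendsto_diff[OF euler_mascheroni_LIMSEQ lim_1_over_n] by simp
qed (rule euler_mascheroni_LIMSEQ)

section \<open>The incomplete gamma function at \<open>s = 0\<close>\<close>

lemma has_field_derivative_Ln_minus_Ein:
  assumes "z \<notin> \<real>\<^sub>\<le>\<^sub>0"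
  shows "((\<lambda>w. Ln w - Ein w) has_field_derivative exp (- z) / z) (at z)"
proof -
  from assms have "z \<noteq> 0" by auto
  with assms show ?thesis
    by (auto intro!: derivative_eq_intros has_field_derivative_Ein simp: field_simps)
qed

text \<open>For \<open>e = 0\<close> this is the real limit. Moving up from \<open>n\<close> by
  \<open>e\<close> along the line \<open>Re w = n\<close> changes the value by at most
  \<open>exp (- n) * e\<close>, because the derivative \<open>exp (- w) / w\<close> has norm at most
  \<open>exp (- n)\<close> there once \<open>n >= 1\<close>.\<close>

lemma Ln_minus_Ein_LIMSEQ:
  assumes "e \<ge> 0"
  shows "(\<lambda>n. Ln (Complex (real n) e) - Ein (Complex (real n) e)) \<longlonglongrightarrow> - euler_mascheroni"
proof -
  define F where "F = (\<lambda>w. Ln w - Ein w)"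
  have "(\<lambda>n. complex_of_real (- (Ein (real n) - ln (real n)))) \<longlonglongrightarrow> of_real (- euler_mascheroni)"
    by (intro tendsto_intros Ein_minus_ln_LIMSEQ)
  moreover have "eventually
      (\<lambda>n. complex_of_real (- (Ein (real n) - ln (real n))) = F (of_nat n)) sequentially"
    using eventually_gt_at_top[of 0]
  proof eventually_elim
    case (elim n)
    then show ?case
      using Ein_of_real[of "real n", where 'a=complex] by (simp add: F_def)
  qed
  ultimately have lim: "(\<lambda>n. F (of_nat n)) \<longlonglongrightarrow> - euler_mascheroni"
    by (simp add: tendsto_cong)
  have "(\<lambda>n. F (Complex (real n) e) - F (of_nat n)) \<longlonglongrightarrow> 0"
  proof (rule Lim_null_comparison)
    show "(\<lambda>n. exp (- real n) * e) \<longlonglongrightarrow> 0"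
      by real_asymp
    show "eventually (\<lambda>n. norm (F (Complex (real n) e) - F (of_nat n)) \<le> exp (- real n) * e) sequentially"
      using eventually_ge_at_top[of 1]
    proof eventually_elim
      case (elim n)
      have "norm (F (Complex (real n) e) - F (of_nat n))
          \<le> exp (- real n) * norm (Complex (real n) e - of_nat n)"
      proof (rule field_differentiable_bound[of "{w. Re w = real n}" F "\<lambda>w. exp (- w) / w"])
        show "convex {w. Re w = real n}"
          using convex_hyperplane[of "1::complex" "real n"] by (simp add: inner_complex_def)
        fix w assume w: "w \<in> {w. Re w = real n}"
        then have "w \<notin> \<real>\<^sub>\<le>\<^sub>0"
          using elim by (auto simp: complex_nonpos_Reals_iff)
        then show "(F has_field_derivative exp (- w) / w) (at w within {w. Re w = real n})"
          unfolding F_def by (intro DERIV_subset[OF has_field_derivative_Ln_minus_Ein]) auto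
        have "1 \<le> norm w"
          using w elim complex_Re_le_cmod[of w] by simp
        then have "exp (- real n) / norm w \<le> exp (- real n) / 1"
          by (intro divide_left_mono) auto
        then show "norm (exp (- w) / w) \<le> exp (- real n)"
          using w by (simp add: norm_divide)
      qed auto
      also have "norm (Complex (real n) e - of_nat n) = e"
        using assms by (simp add: cmod_def)
      finally show ?case .
    qed
  qed
  from tendsto_add[OF this lim] show ?thesis
    by (simp add: F_def)
qed

text \<open>Absolute integrability refers to the completed measure, the integrals of the theorem to
  \<open>lborel\<close>; Borel measurability bridges the two.\<close>

lemma set_integrable_lborel_if_absolutely_integrable:
  fixes f :: "real \<Rightarrow> real"
  assumes "f absolutely_integrable_on S" "set_borel_measurable borel S f"
  shows "set_integrable lborel S f"
  using assms integrable_completion[of "\<lambda>x. indicator S x *\<^sub>R f x" lborel]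
  unfolding set_integrable_def set_borel_measurable_def by simp

lemma set_integrable_exp_minus_atLeast: "set_integrable lborel {x..} (\<lambda>t::real. exp (- t))"
proof (rule set_integrable_lborel_if_absolutely_integrable)
  show "(\<lambda>t::real. exp (- t)) absolutely_integrable_on {x..}"
    using integrable_on_exp_minus_to_infinity[of 1 x]
    by (intro nonnegative_absolutely_integrable_1) auto
qed (simp add: set_borel_measurable_def)

text \<open>The hypothesis keeps the ray off the branch cut, so the primitive
  \<open>Ln w - Ein w\<close> is available on all of it; its limit at the far end is already
  known.\<close>

lemma LINT_exp_minus_over_horizontal_ray:
  assumes "e > 0 \<or> e = 0 \<and> x > 0"
  shows "(LINT t:{x..}|lborel. Complex t e powr (0 - 1) * exp (- Complex t e)) =
           Ein (Complex x e) - euler_mascheroni - Ln (Complex x e)"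
proof -
  define f where "f = (\<lambda>t. exp (- Complex t e) / Complex t e)"
  define F where "F = (\<lambda>w. Ln w - Ein w)"
  \<comment> \<open>A positive lower bound for the distance from 0 to the ray, so that
    \<open>exp (- t) / d\<close> dominates the integrand.\<close>
  define d where "d = (if e > 0 then e else x)"
  have "d > 0"
    using assms by (auto simp: d_def)
  have notin: "Complex t e \<notin> \<real>\<^sub>\<le>\<^sub>0" and norm_ge: "norm (Complex t e) \<ge> d" if "t \<ge> x" for t
    using assms that abs_Im_le_cmod[of "Complex t e"] abs_Re_le_cmod[of "Complex t e"]
    by (auto simp: complex_nonpos_Reals_iff d_def)
  have nz: "Complex t e \<noteq> 0" if "t \<ge> x" for t
    using norm_ge[OF that] \<open>d > 0\<close> by auto
  have powr_eq: "Complex t e powr (0 - 1) * exp (- Complex t e) = f t" if "t \<ge> x" for t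
    using nz[OF that] by (simp add: f_def powr_def exp_minus field_simps)
  have "continuous_on {x..} f"
    unfolding f_def Complex_eq by (intro continuous_intros) (use nz in \<open>auto simp: Complex_eq\<close>)
  then have meas: "set_borel_measurable borel {x..} f"
    unfolding set_borel_measurable_def
    using borel_measurable_continuous_on_indicator[of "{x..}" f] by simp
  have int: "set_integrable lborel {x..} f"
  proof (rule set_integrable_bound)
    show "set_integrable lborel {x..} (\<lambda>t. exp (- t) / d)"
      by (intro set_integrable_divide set_integrable_exp_minus_atLeast)
    show "set_borel_measurable lborel {x..} f"
      using meas by (simp add: set_borel_measurable_def)
    show "AE t in lborel. t \<in> {x..} \<longrightarrow> norm (f t) \<le> norm (exp (- t) / d)"
    proof (intro AE_I2 impI)
      fix t assume t: "t \<in> {x..}"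
      then have "exp (- t) / norm (Complex t e) \<le> exp (- t) / d"
        using norm_ge[of t] \<open>d > 0\<close> nz by (intro divide_left_mono mult_pos_pos) auto
      then show "norm (f t) \<le> norm (exp (- t) / d)"
        using \<open>d > 0\<close> by (simp add: f_def norm_divide)
    qed
  qed
  have "((\<lambda>b. LINT t:{x..b}|lborel. f t) \<longlongrightarrow> (LINT t:{x..}|lborel. f t)) at_top"
    using int by (intro tendsto_set_lebesgue_integral_at_top) auto
  then have "(\<lambda>n. LINT t:{x..real n}|lborel. f t) \<longlonglongrightarrow> (LINT t:{x..}|lborel. f t)"
    by (rule filterlim_compose) (rule filterlim_real_sequentially)
  moreover have "eventually
      (\<lambda>n. (LINT t:{x..real n}|lborel. f t) = F (Complex (real n) e) - F (Complex x e)) sequentially"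
    using eventually_ge_at_top[of "nat \<lceil>x\<rceil>"]
  proof eventually_elim
    case (elim n)
    then have "x \<le> real n" by linarith
    have "(f has_integral F (Complex (real n) e) - F (Complex x e)) {x..real n}"
    proof (rule fundamental_theorem_of_calculus[OF \<open>x \<le> real n\<close>])
      fix t assume t: "t \<in> {x..real n}"
      have line: "((\<lambda>t. Complex t e) has_vector_derivative 1) (at t within {x..real n})"
        unfolding Complex_eq by (auto intro!: derivative_eq_intros)
      have "(F has_field_derivative f t) (at (Complex t e))"
        unfolding F_def f_def using t by (intro has_field_derivative_Ln_minus_Ein notin) auto
      from field_vector_diff_chain_within[OF line DERIV_subset[OF this]]
      show "((\<lambda>t. F (Complex t e)) has_vector_derivative f t) (at t within {x..real n})"
        by (simp add: o_def)
    qed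
    moreover have "set_integrable lborel {x..real n} f"
      by (rule set_integrable_subset[OF int]) auto
    ultimately show ?case
      by (simp add: set_borel_integral_eq_integral(2) integral_unique)
  qed
  ultimately have "(\<lambda>n. F (Complex (real n) e) - F (Complex x e)) \<longlonglongrightarrow> (LINT t:{x..}|lborel. f t)"
    by (simp add: tendsto_cong)
  moreover have "(\<lambda>n. F (Complex (real n) e) - F (Complex x e)) \<longlonglongrightarrow> - euler_mascheroni - F (Complex x e)"
    unfolding F_def using assms by (intro tendsto_diff[OF Ln_minus_Ein_LIMSEQ] tendsto_const) auto
  ultimately have "(LINT t:{x..}|lborel. f t) = - euler_mascheroni - F (Complex x e)"
    by (rule LIMSEQ_unique)
  moreover have "(LINT t:{x..}|lborel. Complex t e powr (0 - 1) * exp (- Complex t e)) =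
      (LINT t:{x..}|lborel. f t)"
    by (rule set_lebesgue_integral_cong) (use powr_eq in auto)
  ultimately show ?thesis
    by (simp add: F_def)
qed

text \<open>Above the cut, and on it, \<open>Ln z = Ln (- z) + \<i> * pi\<close>; here
  \<open>- z\<close> has positive real part, where \<open>Ln\<close> is continuous.\<close>

lemma Ln_tendsto_from_above:
  assumes "x < 0"
  shows "((\<lambda>e. Ln (Complex x e)) \<longlongrightarrow> Ln (complex_of_real x)) (at_right 0)"
proof -
  have eq: "Ln (Complex x e) = Ln (- Complex x e) + \<i> * pi" if "e \<ge> 0" for e
    using Ln_minus[of "- Complex x e"] assms that by (auto simp: complex_eq_iff)
  have "((\<lambda>e. Ln (- Complex x e) + \<i> * pi) \<longlongrightarrow> Ln (- Complex x 0) + \<i> * pi) (at_right 0)"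
    unfolding Complex_eq using assms by (intro tendsto_intros) (auto simp: complex_nonpos_Reals_iff)
  moreover have "eventually (\<lambda>e. Ln (- Complex x e) + \<i> * pi = Ln (Complex x e)) (at_right 0)"
    using eventually_at_right_less[of 0] by eventually_elim (simp add: eq)
  ultimately have "((\<lambda>e. Ln (Complex x e)) \<longlongrightarrow> Ln (- Complex x 0) + \<i> * pi) (at_right 0)"
    by (rule Lim_transform_eventually)
  then show ?thesis
    using eq[of 0] by (simp add: complex_of_real_def)
qed

text \<open>For positive \<open>x\<close> this is the ray formula at height 0. For negative
  \<open>x\<close> the height tends to 0 from the right, \<open>Ein\<close> being continuous and
  \<open>Ln\<close> continuous from above.\<close>

lemma inc_Gamma_0:
  assumes "x \<noteq> 0"
  shows "inc_Gamma 0 x = of_real (Ein x) - euler_mascheroni - Ln (of_real x)"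
proof (cases "x > 0")
  case True
  then show ?thesis
    using LINT_exp_minus_over_horizontal_ray[of 0 x] Ein_of_real[of x, where 'a=complex]
    by (simp add: inc_Gamma_def complex_of_real_def)
next
  case False
  with assms have "x < 0" by simp
  have "((\<lambda>e. Ein (Complex x e)) \<longlongrightarrow> Ein (Complex x 0)) (at_right 0)"
    unfolding Complex_eq by (rule isCont_tendsto_compose[OF isCont_Ein]) (intro tendsto_intros)
  then have "((\<lambda>e. Ein (Complex x e) - euler_mascheroni - Ln (Complex x e)) \<longlongrightarrow>
      of_real (Ein x) - euler_mascheroni - Ln (of_real x)) (at_right 0)"
    using Ein_of_real[of x, where 'a=complex] \<open>x < 0\<close>
    by (intro tendsto_diff tendsto_const Ln_tendsto_from_above) (simp_all add: complex_of_real_def)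
  moreover have "eventually (\<lambda>e. Ein (Complex x e) - euler_mascheroni - Ln (Complex x e) =
      (LINT t:{x..}|lborel. Complex t e powr (0 - 1) * exp (- Complex t e))) (at_right 0)"
    using eventually_at_right_less[of 0]
    by eventually_elim (subst LINT_exp_minus_over_horizontal_ray, auto)
  ultimately have "((\<lambda>e. LINT t:{x..}|lborel. Complex t e powr (0 - 1) * exp (- Complex t e)) \<longlongrightarrow>
      of_real (Ein x) - euler_mascheroni - Ln (of_real x)) (at_right 0)"
    by (rule Lim_transform_eventually)
  from tendsto_Lim[OF _ this] \<open>x < 0\<close> show ?thesis
    by (simp add: inc_Gamma_def)
qed

section \<open>The integrals over the unit interval\<close>

text \<open>Continuity up to 0 allows the fundamental theorem to be used with derivatives in the
  open interval only.\<close>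

lemma continuous_on_x_ln_x: "continuous_on {0..1} (\<lambda>x::real. x * ln x)"
proof (rule continuous_on_IccI)
  show "((\<lambda>x::real. x * ln x) \<longlongrightarrow> 0 * ln 0) (at_right 0)"
    by simp real_asymp
  show "((\<lambda>x::real. x * ln x) \<longlongrightarrow> 1 * ln 1) (at_left 1)"
    by (intro tendsto_intros) auto
  show "((\<lambda>x::real. x * ln x) \<longlongrightarrow> x * ln x) (at x)" if "0 < x" "x < 1" for x
    using that by (intro tendsto_intros) auto
qed auto

lemma ln_absolutely_integrable: "ln absolutely_integrable_on {0..1::real}"
proof -
  have "((\<lambda>x. - ln x) has_integral ((1 - 1 * ln 1) - (0 - 0 * ln 0))) {0..1::real}"
    by (rule fundamental_theorem_of_calculus_interior[where f = "\<lambda>x. x - x * ln x"])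
       (auto intro!: derivative_eq_intros continuous_intros continuous_on_x_ln_x
             simp flip: has_real_derivative_iff_has_vector_derivative)
  \<comment> \<open>Nonnegativity at the end point 0 rests on the convention
    \<open>ln 0 = 0\<close>.\<close>
  then have "(\<lambda>x::real. - ln x) absolutely_integrable_on {0..1}"
    by (intro nonnegative_absolutely_integrable_1) (auto simp: has_integral_integrable order_le_less)
  then show ?thesis
    using set_integrable_mult_right[of "-1::real" lebesgue "{0..1}" "\<lambda>x. - ln x"] by simp
qed

lemma set_integrable_continuous_times_ln:
  fixes g :: "real \<Rightarrow> real"
  assumes "continuous_on UNIV g"
  shows "set_integrable lborel {0..1} (\<lambda>x. g x * ln x)"
proof (rule set_integrable_lborel_if_absolutely_integrable)
  have g: "continuous_on {0..1} g"
    using assms continuous_on_subset by blast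
  show "(\<lambda>x. g x * ln x) absolutely_integrable_on {0..1}"
  proof (rule absolutely_integrable_bounded_measurable_product_real)
    show "g \<in> borel_measurable (lebesgue_on {0..1})"
      using g by (intro continuous_imp_measurable_on_sets_lebesgue) auto
    show "bounded (g ` {0..1})"
      using g by (intro compact_imp_bounded compact_continuous_image) auto
  qed (auto intro: ln_absolutely_integrable)
  show "set_borel_measurable borel {0..1} (\<lambda>x. g x * ln x)"
    using borel_measurable_continuous_onI[OF assms] by (simp add: set_borel_measurable_def)
qed

section \<open>Closed forms of the two families of integrals\<close>

lemma P_int_has_integral: "((\<lambda>x. x ^ n * exp (- a * x)) has_integral P_int n a) {0..1}"
proof -
  have "set_integrable lborel {0..1} (\<lambda>x. x ^ n * exp (- a * x))"
    by (intro borel_integrable_atLeastAtMost' continuous_intros)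
  then show ?thesis
    unfolding P_int_def using set_borel_integral_eq_integral by (metis integrable_integral)
qed

lemma P_int_eq:
  assumes "a \<noteq> 0"
  shows "P_int n a = fact n / a ^ (n + 1) * (1 - exp (- a) * Exp_partial n a)"
proof -
  \<comment> \<open>\<open>Exp_partial n\<close> exceeds its derivative by its top term alone, so
    \<open>exp (- y) * Exp_partial n y\<close> has derivative
    \<open>- exp (- y) * y ^ n / fact n\<close>; \<open>F\<close> is this rescaled by
    \<open>y = a * x\<close>.\<close>
  define F where "F = (\<lambda>x. - (fact n / a ^ (n + 1) * (exp (- a * x) * Exp_partial n (a * x))))"
  have Exp': "(Exp_partial n has_real_derivative (Exp_partial n y - y ^ n / fact n)) (at y)" for y
  proof -
    have "(Exp_partial n has_real_derivative (\<Sum>k=0..n. real k * y ^ (k - 1) / fact k)) (at y)"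
      unfolding Exp_partial_def[abs_def]
      by (intro DERIV_sum) (auto intro!: derivative_eq_intros)
    also have "(\<Sum>k=0..n. real k * y ^ (k - 1) / fact k) = Exp_partial n y - y ^ n / fact n"
    proof (induction n)
      case (Suc n)
      have "real (Suc n) * y ^ n / fact (Suc n) = y ^ n / fact n"
        by (simp del: of_nat_Suc)
      with Suc show ?case
        by (simp add: Exp_partial_def del: of_nat_Suc fact_Suc power_Suc)
    qed (simp add: Exp_partial_def)
    finally show ?thesis .
  qed
  have F': "(F has_real_derivative x ^ n * exp (- a * x)) (at x)" for x
    unfolding F_def using assms
    by (auto intro!: derivative_eq_intros DERIV_chain2[OF Exp'] simp: field_simps power_mult_distrib)
  have "((\<lambda>x. x ^ n * exp (- a * x)) has_integral F 1 - F 0) {0..1}"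
    by (rule fundamental_theorem_of_calculus)
       (use F' in \<open>simp_all add: has_field_derivative_at_within
          flip: has_real_derivative_iff_has_vector_derivative\<close>)
  from has_integral_unique[OF P_int_has_integral this] have "P_int n a = F 1 - F 0" .
  moreover have "Exp_partial n 0 = 1"
    by (induction n) (simp_all add: Exp_partial_def)
  ultimately show ?thesis
    by (simp add: F_def algebra_simps)
qed

lemma Q_int_has_integral: "((\<lambda>x. x ^ n * exp (- a * x) * ln x) has_integral Q_int n a) {0..1}"
proof -
  have "set_integrable lborel {0..1} (\<lambda>x. x ^ n * exp (- a * x) * ln x)"
    by (intro set_integrable_continuous_times_ln continuous_intros)
  then show ?thesis
    unfolding Q_int_def using set_borel_integral_eq_integral by (metis integrable_integral)
qed

lemma Q_int_Suc: "a * Q_int (Suc n) a = real (Suc n) * Q_int n a + P_int n a"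
proof -
  \<comment> \<open>Splitting off \<open>x * ln x\<close> gives continuity at 0 even for
    \<open>n = 0\<close>. The product vanishes at both end points, so no boundary term
    remains.\<close>
  let ?F = "\<lambda>x::real. x ^ n * exp (- a * x) * (x * ln x)"
  let ?f = "\<lambda>x. real (Suc n) * (x ^ n * exp (- a * x) * ln x)
              - a * (x ^ Suc n * exp (- a * x) * ln x) + x ^ n * exp (- a * x)"
  have "(?f has_integral ?F 1 - ?F 0) {0..1}"
  proof (rule fundamental_theorem_of_calculus_interior)
    fix x :: real assume x: "x \<in> {0<..<1}"
    have pow: "((\<lambda>x. x ^ Suc n) has_real_derivative real (Suc n) * x ^ n) (at x)"
      using DERIV_pow[of "Suc n" x] by simp
    have exp: "((\<lambda>x. exp (- a * x)) has_real_derivative - a * exp (- a * x)) (at x)"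
      by (auto intro!: derivative_eq_intros)
    have ln: "(ln has_real_derivative 1 / x) (at x)"
      using x by (intro DERIV_ln_divide) auto
    have "((\<lambda>x. x ^ Suc n * exp (- a * x) * ln x) has_real_derivative ?f x) (at x)"
      by (rule DERIV_cong[OF DERIV_mult[OF DERIV_mult[OF pow exp] ln]])
         (use x in \<open>simp add: field_simps\<close>)
    then show "(?F has_vector_derivative ?f x) (at x)"
      by (simp add: mult_ac flip: has_real_derivative_iff_has_vector_derivative)
  qed (auto intro!: continuous_intros continuous_on_x_ln_x)
  moreover have "(?f has_integral real (Suc n) * Q_int n a - a * Q_int (Suc n) a + P_int n a) {0..1}"
    by (intro has_integral_add has_integral_diff has_integral_mult_right
        Q_int_has_integral P_int_has_integral)
  ultimately have "real (Suc n) * Q_int n a - a * Q_int (Suc n) a + P_int n a = ?F 1 - ?F 0"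
    by (rule has_integral_unique[rotated])
  then show ?thesis by simp
qed

text \<open>The case \<open>n = 0\<close> is the definition of \<open>G_fun\<close>. In the
  recurrence, the closed form of \<open>P_int n a\<close> contributes \<open>1 / (n + 1)\<close> to
  the harmonic number and the term \<open>k = n + 1\<close> to the sum.\<close>

lemma Q_int_eq:
  assumes "a \<noteq> 0"
  shows "Q_int n a = fact n / a ^ (n + 1) *
           (harm n - G_fun a - exp (- a) * (\<Sum>k=1..n. 1 / real k * Exp_partial (k - 1) a))"
proof (induction n)
  case 0
  then show ?case
    using assms by (simp add: G_fun_def harm_def)
next
  case (Suc n)
  have "Q_int (Suc n) a = (real (Suc n) * Q_int n a + P_int n a) / a"
    using Q_int_Suc[of a n] assms by (simp add: field_simps)
  also have "\<dots> = fact (Suc n) / a ^ (Suc n + 1) *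
      ((harm n - G_fun a - exp (- a) * (\<Sum>k=1..n. 1 / real k * Exp_partial (k - 1) a)) +
       (1 - exp (- a) * Exp_partial n a) / real (Suc n))"
    unfolding Suc.IH P_int_eq[OF assms] using assms
    by (simp add: divide_simps del: of_nat_Suc) (simp add: algebra_simps)
  finally show ?case
    by (simp add: harm_Suc algebra_simps diff_divide_distrib inverse_eq_divide
        del: of_nat_Suc fact_Suc power_Suc)
qed

section \<open>Identification of \<open>G_fun\<close> with \<open>Ein\<close>\<close>

lemma continuous_on_one_minus_exp_times_ln:
  "continuous_on {0..1} (\<lambda>x::real. (1 - exp (- a * x)) * ln x)"
proof (rule continuous_on_IccI)
  \<comment> \<open>\<open>1 - exp (- a * x)\<close> is of order \<open>x\<close> at 0 and so
    outweighs \<open>ln x\<close>; the asymptotic expansion is computed for each sign of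
    \<open>a\<close>.\<close>
  consider "a > 0" | "a = 0" | "a < 0" by linarith
  then show "((\<lambda>x. (1 - exp (- a * x)) * ln x) \<longlongrightarrow> (1 - exp (- a * 0)) * ln 0) (at_right 0)"
    by cases (simp, real_asymp)+
  show "((\<lambda>x. (1 - exp (- a * x)) * ln x) \<longlongrightarrow> (1 - exp (- a * 1)) * ln 1) (at_left 1)"
    by (intro tendsto_intros) auto
  show "((\<lambda>x. (1 - exp (- a * x)) * ln x) \<longlongrightarrow> (1 - exp (- a * x)) * ln x) (at x)" if "0 < x" "x < 1" for x
    using that by (intro tendsto_intros) auto
qed auto

lemma G_fun_eq_Ein:
  assumes "a \<noteq> 0"
  shows "G_fun a = Ein a"
proof -
  \<comment> \<open>The constant 1 makes the first product vanish at 0, at the price of an extra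
    \<open>(1 - exp (- a * x)) / x\<close> in the derivative, which \<open>Ein (a * x)\<close>
    cancels.\<close>
  let ?F = "\<lambda>x. (1 - exp (- a * x)) * ln x - Ein (a * x)"
  have "((\<lambda>x. a * (x ^ 0 * exp (- a * x) * ln x)) has_integral ?F 1 - ?F 0) {0..1}"
  proof (rule fundamental_theorem_of_calculus_interior)
    fix x :: real assume x: "x \<in> {0<..<1}"
    then have "(?F has_real_derivative a * (x ^ 0 * exp (- a * x) * ln x)) (at x)"
      using assms
      by (auto intro!: derivative_eq_intros DERIV_chain2[OF has_field_derivative_Ein] simp: field_simps)
    then show "(?F has_vector_derivative a * (x ^ 0 * exp (- a * x) * ln x)) (at x)"
      by (simp add: has_real_derivative_iff_has_vector_derivative)
  qed (auto intro!: continuous_intros continuous_on_one_minus_exp_times_ln[simplified])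
  moreover have "((\<lambda>x. a * (x ^ 0 * exp (- a * x) * ln x)) has_integral a * Q_int 0 a) {0..1}"
    by (intro has_integral_mult_right Q_int_has_integral)
  ultimately have "a * Q_int 0 a = ?F 1 - ?F 0"
    by (rule has_integral_unique[rotated])
  then show ?thesis
    by (simp add: G_fun_def)
qed

text \<open>The last identity is complex because for negative \<open>a\<close> both
  \<open>inc_Gamma 0 a\<close> and \<open>Ln a\<close> are non-real; their imaginary parts
  \<open>- pi\<close> and \<open>pi\<close> cancel.\<close>

theorem theorem4p5:
  fixes a :: real and n :: nat
  assumes "a \<noteq> 0"
  shows "P_int n a = fact n / a ^ (n + 1) * (1 - exp (- a) * Exp_partial n a)
    \<and> Q_int n a = fact n / a ^ (n + 1) *
           (harm n - G_fun a - exp (- a) * (\<Sum>k=1..n. 1 / real k * Exp_partial (k - 1) a))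
    \<and> complex_of_real (G_fun a) = euler_mascheroni + inc_Gamma 0 a + Ln (complex_of_real a)"
  using P_int_eq[OF assms] Q_int_eq[OF assms] G_fun_eq_Ein[OF assms] inc_Gamma_0[OF assms] by simp

end
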